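(* The group $\operatorname{Diff}_0(\mathbb{R})$ has commutator width one.
   Context: $\operatorname{Diff}(\mathbb{R})$ is the group of ($C^\infty$) diffeomorphisms $\mathbb{R} \to \mathbb{R}$ equipped with the compact-open $C^\infty$-topology, and $\operatorname{Diff}_0(\mathbb{R})$ is the connected component of the identity in $\operatorname{Diff}(\mathbb{R})$. The commutator width of a group $G$ is the smallest natural number $p \geq 1$ such that every element of the commutator subgroup $[G,G]$ can be expressed as a product of $p$ elements of the set $\{ aba^{-1}b^{-1} , (aba^{-1}b^{-1})^{-1} : a, b \in G\}$ (and is infinite if no such $p$ exists). *)

theory Defs
  imports "HOL-Analysis.Analysis" "HOL-Algebra.Generated_Groups"
begin

definition smooth_real :: "(real \<Rightarrow> real) \<Rightarrow> bool" where
  "smooth_real f \<longleftrightarrow> (\<forall>k x. (deriv ^^ k) f field_differentiable (at x))"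

text \<open>We write \<open>inv_into UNIV f\<close> for the inverse function of \<open>f\<close>, as the notation \<open>inv\<close>
  is also used for inverses in the group library.\<close>

definition diffeos_real :: "(real \<Rightarrow> real) set" where
  "diffeos_real = {f. bij f \<and> smooth_real f \<and> smooth_real (inv_into UNIV f)}"

definition Diff_real :: "(real \<Rightarrow> real) monoid" where
  "Diff_real = \<lparr>carrier = diffeos_real, mult = (\<circ>), one = id\<rparr>"

definition Ck_nbhd :: "(real \<Rightarrow> real) \<Rightarrow> real set \<Rightarrow> nat \<Rightarrow> real \<Rightarrow> (real \<Rightarrow> real) set" where
  "Ck_nbhd f K k e =
     {g \<in> diffeos_real. \<forall>j\<le>k. \<forall>x\<in>K. \<bar>(deriv ^^ j) g x - (deriv ^^ j) f x\<bar> < e}"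

text \<open>The compact-open \<open>C\<^sup>\<infinity>\<close>-topology (also called the weak \<open>C\<^sup>\<infinity>\<close>-topology), that is, uniform
  convergence of all derivatives on compact sets, restricted to the diffeomorphisms. Its
  underlying set is all of \<^const>\<open>diffeos_real\<close>, since every \<open>f\<close> lies in its own neighbourhoods.\<close>

definition compact_open_smooth_topology :: "(real \<Rightarrow> real) topology" where
  "compact_open_smooth_topology =
     topology_generated_by {Ck_nbhd f K k e | f K k e. f \<in> diffeos_real \<and> compact K \<and> 0 < e}"

definition Diff0_real :: "(real \<Rightarrow> real) monoid" where
  "Diff0_real =
     Diff_real\<lparr>carrier := {f. connected_component_of compact_open_smooth_topology id f}\<rparr>"

definition commutators :: "('a, 'b) monoid_scheme \<Rightarrow> 'a set" where
  "commutators G = {a \<otimes>\<^bsub>G\<^esub> b \<otimes>\<^bsub>G\<^esub> inv\<^bsub>G\<^esub> a \<otimes>\<^bsub>G\<^esub> inv\<^bsub>G\<^esub> b | a b. a \<in> carrier G \<and> b \<in> carrier G}"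

definition products_of_length :: "('a, 'b) monoid_scheme \<Rightarrow> nat \<Rightarrow> 'a set \<Rightarrow> 'a set" where
  "products_of_length G p S =
     {foldr (\<lambda>x y. x \<otimes>\<^bsub>G\<^esub> y) xs \<one>\<^bsub>G\<^esub> | xs. set xs \<subseteq> S \<and> length xs = p}"

text \<open>The infimum of the empty set in \<^typ>\<open>enat\<close> is \<open>\<infinity>\<close>, and a nonempty infimum is attained.\<close>

definition commutator_width :: "('a, 'b) monoid_scheme \<Rightarrow> enat" where
  "commutator_width G =
     Inf {enat p | p. 1 \<le> p \<and>
       derived G (carrier G) \<subseteq>
         products_of_length G p (commutators G \<union> {inv\<^bsub>G\<^esub> c | c. c \<in> commutators G})}"

end

theory Submission
  imports Defs
begin

text \<open>The identity component of the diffeomorphism group consists of the increasing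
  diffeomorphisms (\<open>identity_component_eq_increasing_diffeos\<close>): the sign of the derivative at a
  point is locally constant, and an increasing diffeomorphism \<open>f\<close> is joined to the identity by the
  straight path \<open>(1 - t) x + t f x\<close>.

  Every increasing diffeomorphism \<open>f\<close> is a single commutator
  (\<open>increasing_diffeo_is_commutator\<close>). Choose an increasing diffeomorphism \<open>h\<close> such that both \<open>h\<close>
  and \<open>f \<circ> h\<close> move every point to the right; \<open>h x = ln (exp x + exp (f\<inverse> x))\<close> does this
  (\<open>increasing_diffeo_dominating\<close>). A diffeomorphism moving every point to the right is conjugate,
  by an increasing diffeomorphism, to the translation by \<open>1\<close> (\<open>abel_function_exists\<close>). Hence
  \<open>f \<circ> h = g \<circ> h \<circ> g\<inverse>\<close> for some \<open>g\<close>, which says that \<open>f\<close> is the commutator of \<open>g\<close> and \<open>h\<close>.\<close>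

section \<open>Closure properties of smooth functions\<close>

text \<open>Smoothness is not visibly stable under products, composition or inversion, because the
  higher derivatives of such functions are unwieldy. Finite orders of differentiability, together
  with the recursion \<open>times_differentiable_Suc\<close> on the \<^emph>\<open>first\<close> derivative, turn each closure
  property into an induction that only needs the ordinary first-order rule.\<close>

definition times_differentiable :: "nat \<Rightarrow> (real \<Rightarrow> real) \<Rightarrow> bool" where
  "times_differentiable n f \<longleftrightarrow> (\<forall>k<n. \<forall>x. (deriv ^^ k) f field_differentiable (at x))"

lemma smooth_real_iff_times_differentiable: "smooth_real f \<longleftrightarrow> (\<forall>n. times_differentiable n f)"
  unfolding smooth_real_def times_differentiable_def by blast

lemma times_differentiable_0 [simp]: "times_differentiable 0 f"
  by (simp add: times_differentiable_def)

lemma times_differentiable_Suc: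
  "times_differentiable (Suc n) f \<longleftrightarrow>
     (\<forall>x. f field_differentiable (at x)) \<and> times_differentiable n (deriv f)"
  unfolding times_differentiable_def All_less_Suc2 by (simp add: funpow_swap1)

lemma times_differentiable_SucI:
  assumes "\<And>x. (f has_field_derivative f' x) (at x)" "times_differentiable n f'"
  shows "times_differentiable (Suc n) f"
proof -
  have "deriv f = f'"
    using assms(1) by (auto intro: DERIV_imp_deriv)
  then show ?thesis
    using assms by (auto simp: times_differentiable_Suc field_differentiable_def)
qed

lemma times_differentiable_SucD:
  assumes "times_differentiable (Suc n) f"
  shows "times_differentiable n f" "times_differentiable n (deriv f)"
  using assms by (simp add: times_differentiable_def, simp add: times_differentiable_Suc)

lemma times_differentiable_has_derivative:
  "times_differentiable (Suc n) f \<Longrightarrow> (f has_field_derivative deriv f x) (at x)"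
  by (simp add: times_differentiable_Suc field_differentiable_derivI)

lemma times_differentiable_const: "times_differentiable n (\<lambda>x. c)"
proof (induction n arbitrary: c)
  case (Suc n)
  show ?case
    by (rule times_differentiable_SucI[where f' = "\<lambda>_. 0"]) (simp_all add: Suc)
qed simp

lemma times_differentiable_ident: "times_differentiable n (\<lambda>x. x)"
proof (cases n)
  case (Suc m)
  show ?thesis
    unfolding Suc by (rule times_differentiable_SucI[OF _ times_differentiable_const[of _ 1]]) simp
qed simp

lemma times_differentiable_add:
  "times_differentiable n f \<Longrightarrow> times_differentiable n g \<Longrightarrow> times_differentiable n (\<lambda>x. f x + g x)"
proof (induction n arbitrary: f g)
  case (Suc n)
  have "times_differentiable n (\<lambda>x. deriv f x + deriv g x)"
    using Suc by (auto dest: times_differentiable_SucD)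
  then show ?case
    by (rule times_differentiable_SucI[rotated])
      (intro DERIV_add times_differentiable_has_derivative[OF Suc.prems(1)]
        times_differentiable_has_derivative[OF Suc.prems(2)])
qed simp

lemma times_differentiable_mult:
  "times_differentiable n f \<Longrightarrow> times_differentiable n g \<Longrightarrow> times_differentiable n (\<lambda>x. f x * g x)"
proof (induction n arbitrary: f g)
  case (Suc n)
  have "times_differentiable n f" "times_differentiable n g"
       "times_differentiable n (deriv f)" "times_differentiable n (deriv g)"
    using Suc.prems by (auto dest: times_differentiable_SucD)
  then have "times_differentiable n (\<lambda>x. deriv f x * g x + deriv g x * f x)"
    by (intro times_differentiable_add Suc.IH)
  then show ?case
    by (rule times_differentiable_SucI[rotated])
      (intro DERIV_mult times_differentiable_has_derivative[OF Suc.prems(1)]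
        times_differentiable_has_derivative[OF Suc.prems(2)])
qed simp

lemma times_differentiable_compose:
  "times_differentiable n f \<Longrightarrow> times_differentiable n g \<Longrightarrow> times_differentiable n (\<lambda>x. f (g x))"
proof (induction n arbitrary: f g)
  case (Suc n)
  note prems = times_differentiable_SucD[OF Suc.prems(1)] times_differentiable_SucD[OF Suc.prems(2)]
  have "times_differentiable n (\<lambda>x. deriv f (g x) * deriv g x)"
    by (rule times_differentiable_mult[OF Suc.IH[OF prems(2,3)] prems(4)])
  then show ?case
    by (rule times_differentiable_SucI[rotated])
      (rule DERIV_chain2[OF times_differentiable_has_derivative[OF Suc.prems(1)]
        times_differentiable_has_derivative[OF Suc.prems(2)]])
qed simp

lemma times_differentiable_inverse:
  assumes "\<And>x. f x \<noteq> 0"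
  shows "times_differentiable n f \<Longrightarrow> times_differentiable n (\<lambda>x. inverse (f x))"
proof (induction n)
  case (Suc n)
  have "times_differentiable n (\<lambda>x. inverse (f x))" "times_differentiable n (deriv f)"
    using Suc by (auto dest: times_differentiable_SucD)
  then have "times_differentiable n (\<lambda>x. (- 1) * (inverse (f x) * deriv f x * inverse (f x)))"
    by (intro times_differentiable_mult times_differentiable_const)
  then show ?case
    by (intro times_differentiable_SucI[of "\<lambda>x. inverse (f x)"])
      (use DERIV_inverse'[OF times_differentiable_has_derivative[OF Suc.prems(1)]] assms in auto)
qed simp

text \<open>Smoothness is a local property, which makes locally finite sums of smooth functions smooth.\<close>

lemma times_differentiable_locally:
  assumes "\<And>x. \<exists>g. times_differentiable n g \<and> (\<forall>\<^sub>F y in nhds x. f y = g y)"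
  shows "times_differentiable n f"
  using assms
proof (induction n arbitrary: f)
  case (Suc n)
  have "f field_differentiable (at x) \<and>
      (\<exists>g. times_differentiable n g \<and> (\<forall>\<^sub>F y in nhds x. deriv f y = g y))" for x
  proof -
    obtain g where g: "times_differentiable (Suc n) g" "\<forall>\<^sub>F y in nhds x. f y = g y"
      using Suc.prems by blast
    have "(f has_field_derivative deriv g x) (at x)"
      using DERIV_cong_ev[OF refl g(2) refl] times_differentiable_has_derivative[OF g(1)] by blast
    moreover have "\<forall>\<^sub>F y in nhds x. \<forall>\<^sub>F z in nhds y. f z = g z"
      using g(2) by (simp add: eventually_eventually)
    then have "\<forall>\<^sub>F y in nhds x. deriv f y = deriv g y"
      by (rule eventually_mono) (auto intro: deriv_cong_ev)
    ultimately show ?thesis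
      using g(1) by (auto simp: times_differentiable_Suc field_differentiable_def)
  qed
  then show ?case
    using Suc.IH by (auto simp: times_differentiable_Suc)
qed simp

lemma smooth_real_has_derivative: "smooth_real f \<Longrightarrow> (f has_field_derivative deriv f x) (at x)"
  by (rule times_differentiable_has_derivative) (simp add: smooth_real_iff_times_differentiable)

lemma smooth_real_isCont: "smooth_real f \<Longrightarrow> isCont f x"
  by (rule DERIV_isCont[OF smooth_real_has_derivative])

lemma smooth_real_continuous_on: "smooth_real f \<Longrightarrow> continuous_on S f"
  by (simp add: smooth_real_isCont continuous_at_imp_continuous_on)

lemma smooth_real_deriv: "smooth_real f \<Longrightarrow> smooth_real (deriv f)"
  using times_differentiable_SucD(2)[of _ f] by (simp add: smooth_real_iff_times_differentiable)

lemma smooth_real_higher_deriv: "smooth_real f \<Longrightarrow> smooth_real ((deriv ^^ k) f)"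
  by (induction k) (simp_all add: smooth_real_deriv)

lemma smooth_realI:
  assumes "\<And>x. (f has_field_derivative f' x) (at x)" "smooth_real f'"
  shows "smooth_real f"
proof -
  have "times_differentiable (Suc n) f" for n
    using assms by (intro times_differentiable_SucI) (auto simp: smooth_real_iff_times_differentiable)
  then show ?thesis
    using times_differentiable_SucD(1)[of _ f] by (simp add: smooth_real_iff_times_differentiable)
qed

lemma smooth_real_const: "smooth_real (\<lambda>x. c)"
  by (simp add: smooth_real_iff_times_differentiable times_differentiable_const)

lemma smooth_real_ident: "smooth_real (\<lambda>x. x)"
  by (simp add: smooth_real_iff_times_differentiable times_differentiable_ident)

lemma smooth_real_add: "smooth_real f \<Longrightarrow> smooth_real g \<Longrightarrow> smooth_real (\<lambda>x. f x + g x)"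
  by (simp add: smooth_real_iff_times_differentiable times_differentiable_add)

lemma smooth_real_mult: "smooth_real f \<Longrightarrow> smooth_real g \<Longrightarrow> smooth_real (\<lambda>x. f x * g x)"
  by (simp add: smooth_real_iff_times_differentiable times_differentiable_mult)

lemma smooth_real_diff:
  assumes "smooth_real f" "smooth_real g"
  shows "smooth_real (\<lambda>x. f x - g x)"
  using smooth_real_add[OF assms(1) smooth_real_mult[OF smooth_real_const[of "-1"] assms(2)]] by simp

lemma smooth_real_compose: "smooth_real f \<Longrightarrow> smooth_real g \<Longrightarrow> smooth_real (\<lambda>x. f (g x))"
  by (simp add: smooth_real_iff_times_differentiable times_differentiable_compose)

lemma smooth_real_divide:
  assumes "smooth_real f" "smooth_real g" "\<And>x. g x \<noteq> 0"
  shows "smooth_real (\<lambda>x. f x / g x)"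
proof -
  have "smooth_real (\<lambda>x. inverse (g x))"
    using assms(2) times_differentiable_inverse[OF assms(3)]
    by (simp add: smooth_real_iff_times_differentiable)
  then show ?thesis
    unfolding divide_inverse by (rule smooth_real_mult[OF assms(1)])
qed

lemma smooth_real_sum:
  assumes "\<And>i. i \<in> I \<Longrightarrow> smooth_real (f i)"
  shows "smooth_real (\<lambda>x. \<Sum>i\<in>I. f i x)"
  using assms by (induction I rule: infinite_finite_induct) (auto intro: smooth_real_const smooth_real_add)

lemma smooth_real_locally:
  assumes "\<And>x. \<exists>g. smooth_real g \<and> (\<forall>\<^sub>F y in nhds x. f y = g y)"
  shows "smooth_real f"
proof -
  have "times_differentiable n f" for n
  proof (rule times_differentiable_locally)
    fix x
    obtain g where "smooth_real g" "\<forall>\<^sub>F y in nhds x. f y = g y"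
      using assms by blast
    then show "\<exists>g. times_differentiable n g \<and> (\<forall>\<^sub>F y in nhds x. f y = g y)"
      unfolding smooth_real_iff_times_differentiable by blast
  qed
  then show ?thesis by (simp add: smooth_real_iff_times_differentiable)
qed

lemma smooth_real_exp: "smooth_real exp"
proof -
  have "times_differentiable n exp" for n
  proof (induction n)
    case (Suc n)
    then show ?case by (intro times_differentiable_SucI[OF DERIV_exp])
  qed simp
  then show ?thesis by (simp add: smooth_real_iff_times_differentiable)
qed

lemma smooth_real_ln:
  assumes "smooth_real f" "\<And>x. 0 < f x"
  shows "smooth_real (\<lambda>x. ln (f x))"
proof (rule smooth_realI)
  show "((\<lambda>x. ln (f x)) has_field_derivative deriv f x / f x) (at x)" for x
    using smooth_real_has_derivative[OF assms(1), of x] assms(2)[of x]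
    by (auto intro!: derivative_eq_intros)
  show "smooth_real (\<lambda>x. deriv f x / f x)"
    by (rule smooth_real_divide[OF smooth_real_deriv[OF assms(1)] assms(1) less_imp_neq[OF assms(2), symmetric]])
qed

text \<open>The inverse function theorem on the line: the derivative \<open>1 / f'(g y)\<close> of the inverse \<open>g\<close>
  is a composition involving \<open>g\<close> itself, so each order of differentiability of \<open>g\<close> yields the
  next one.\<close>

lemma inverse_function_has_derivative:
  fixes f g :: "real \<Rightarrow> real"
  assumes "\<And>x. (f has_field_derivative f' x) (at x)" "\<And>x. f' x \<noteq> 0"
    and "\<And>x. g (f x) = x" "\<And>y. f (g y) = y"
  shows "(g has_field_derivative inverse (f' (g y))) (at y)"
proof (rule DERIV_inverse_function[where f = f and a = "y - 1" and b = "y + 1"])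
  have "isCont g (f (g y))"
    by (rule isCont_inverse_function2[where f = f and x = "g y" and a = "g y - 1" and b = "g y + 1"])
      (simp_all add: assms(3) DERIV_isCont[OF assms(1)])
  then show "isCont g y" by (simp add: assms(4))
qed (simp_all add: assms)

lemma smooth_real_inverse_function:
  assumes f: "smooth_real f" and nz: "\<And>x. deriv f x \<noteq> 0"
    and gf: "\<And>x. g (f x) = x" and fg: "\<And>y. f (g y) = y"
  shows "smooth_real g"
proof -
  have "times_differentiable n g" for n
  proof (induction n)
    case (Suc n)
    have "times_differentiable n (\<lambda>y. deriv f (g y))"
      using smooth_real_deriv[OF f] times_differentiable_compose[OF _ Suc]
      by (simp add: smooth_real_iff_times_differentiable)
    then have "times_differentiable n (\<lambda>y. inverse (deriv f (g y)))"
      using nz by (intro times_differentiable_inverse)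
    then show ?case
      using inverse_function_has_derivative[OF smooth_real_has_derivative[OF f] nz gf fg]
      by (intro times_differentiable_SucI)
  qed simp
  then show ?thesis by (simp add: smooth_real_iff_times_differentiable)
qed

section \<open>A smooth step\<close>

text \<open>The derivatives of \<open>exp (- 1 / x)\<close> on the positive half-line are of the form
  \<open>p (1 / x) * exp (- 1 / x)\<close> with a polynomial \<open>p\<close>. Treating all polynomials at once makes the
  class closed under differentiation.\<close>

definition flat_fun :: "real poly \<Rightarrow> real \<Rightarrow> real" where
  "flat_fun p x = (if 0 < x then poly p (1 / x) * exp (- (1 / x)) else 0)"

lemma poly_times_exp_neg_tendsto_0: "((\<lambda>y. poly p y * exp (- y)) \<longlongrightarrow> (0::real)) at_top"
proof -
  have "((\<lambda>y. \<Sum>i\<le>degree p. coeff p i * (y ^ i / exp y)) \<longlongrightarrow> (\<Sum>i\<le>degree p. coeff p i * 0)) at_top"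
    by (intro tendsto_sum tendsto_mult tendsto_const tendsto_power_div_exp_0)
  then show ?thesis
    by (simp add: poly_altdef exp_minus divide_inverse sum_distrib_right mult.assoc)
qed

lemma flat_fun_tendsto_0: "(flat_fun p \<longlongrightarrow> 0) (at_right 0)"
proof -
  have "((\<lambda>x. poly p (inverse x) * exp (- (inverse x))) \<longlongrightarrow> 0) (at_right 0)"
    by (rule filterlim_compose[OF poly_times_exp_neg_tendsto_0 filterlim_inverse_at_top_right])
  then show ?thesis
    by (rule Lim_transform_eventually)
      (auto simp: flat_fun_def eventually_at_right_field divide_inverse intro: exI[of _ 1])
qed

lemma flat_fun_has_derivative:
  "(flat_fun p has_field_derivative flat_fun ([:0, 0, 1:] * (p - pderiv p)) x) (at x)"
proof -
  consider "x < 0" | "x = 0" | "0 < x" by linarith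
  then show ?thesis
  proof cases
    case 1
    have "\<forall>\<^sub>F y in nhds x. flat_fun p y = (\<lambda>y. 0) y"
      using eventually_nhds_in_open[of "{..<0}" x] 1
      by (auto simp: flat_fun_def elim!: eventually_mono)
    then have "(flat_fun p has_field_derivative 0) (at x)"
      using DERIV_cong_ev[OF refl, of "flat_fun p" "\<lambda>y. 0" x 0 0] by simp
    then show ?thesis
      using 1 by (simp add: flat_fun_def)
  next
    case 2
    \<comment> \<open>To the right of \<open>0\<close> the difference quotient is again a function of the same class.\<close>
    have "((\<lambda>h. flat_fun p h / h) \<longlongrightarrow> 0) (at_right 0)"
      by (rule Lim_transform_eventually[OF flat_fun_tendsto_0[of "pCons 0 p"]])
        (auto simp: flat_fun_def eventually_at_right_field intro: exI[of _ 1])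
    moreover have "((\<lambda>h. flat_fun p h / h) \<longlongrightarrow> 0) (at_left 0)"
      by (rule Lim_transform_eventually[OF tendsto_const])
        (auto simp: flat_fun_def eventually_at_left_field intro: exI[of _ "-1"])
    ultimately have "((\<lambda>h. flat_fun p h / h) \<longlongrightarrow> 0) (at 0)"
      by (simp add: filterlim_at_split)
    then show ?thesis
      using 2 by (simp add: DERIV_def flat_fun_def)
  next
    case 3
    have "\<forall>\<^sub>F y in nhds x. flat_fun p y = poly p (1 / y) * exp (- (1 / y))"
      using eventually_nhds_in_open[of "{0<..}" x] 3
      by (auto simp: flat_fun_def elim!: eventually_mono)
    moreover have "((\<lambda>y. poly p (1 / y) * exp (- (1 / y))) has_field_derivative
        flat_fun ([:0, 0, 1:] * (p - pderiv p)) x) (at x)"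
      using 3 by (auto intro!: derivative_eq_intros DERIV_chain2[OF poly_DERIV]
          simp: flat_fun_def field_simps)
    ultimately show ?thesis
      by (subst DERIV_cong_ev[OF refl _ refl])
  qed
qed

lemma smooth_real_flat_fun: "smooth_real (flat_fun p)"
proof -
  have "times_differentiable n (flat_fun p)" for n
  proof (induction n arbitrary: p)
    case (Suc n)
    then show ?case by (intro times_differentiable_SucI[OF flat_fun_has_derivative])
  qed simp
  then show ?thesis by (simp add: smooth_real_iff_times_differentiable)
qed

text \<open>With \<open>\<beta> x = exp (- 1 / x)\<close> for positive \<open>x\<close> and \<open>\<beta> x = 0\<close> otherwise, the quotient
  \<open>\<beta> (x - a) / (\<beta> (x - a) + \<beta> (b - x))\<close> is such a step: its denominator never vanishes because
  \<open>a < b\<close>.\<close>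

lemma smooth_step_exists:
  fixes a b :: real
  assumes "a < b"
  obtains \<psi> where "smooth_real \<psi>" "\<And>x. x \<le> a \<Longrightarrow> \<psi> x = 0" "\<And>x. b \<le> x \<Longrightarrow> \<psi> x = 1"
    "\<And>x. 0 \<le> deriv \<psi> x" "\<And>x. a < x \<Longrightarrow> x < b \<Longrightarrow> 0 < deriv \<psi> x"
proof
  let ?\<beta> = "flat_fun 1" and ?\<beta>' = "flat_fun [:0, 0, 1:]"
  let ?u = "\<lambda>x. ?\<beta> (x - a)" and ?v = "\<lambda>x. ?\<beta> (b - x)"
  let ?u' = "\<lambda>x. ?\<beta>' (x - a)" and ?v' = "\<lambda>x. ?\<beta>' (b - x)"
  let ?\<psi> = "\<lambda>x. ?u x / (?u x + ?v x)"
  have nonneg: "0 \<le> ?\<beta> x" "0 \<le> ?\<beta>' x" for x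
    by (simp_all add: flat_fun_def)
  have pos: "0 < ?\<beta> x" "0 < ?\<beta>' x" if "0 < x" for x
    using that by (simp_all add: flat_fun_def)
  have denominator: "0 < ?u x + ?v x" for x
    using assms pos(1)[of "x - a"] pos(1)[of "b - x"] nonneg(1)[of "x - a"] nonneg(1)[of "b - x"]
    by linarith
  show smooth: "smooth_real ?\<psi>"
    by (intro smooth_real_divide smooth_real_add smooth_real_compose[OF smooth_real_flat_fun]
        smooth_real_diff smooth_real_ident smooth_real_const) (rule less_imp_neq[OF denominator, symmetric])
  show "?\<psi> x = 0" if "x \<le> a" for x
    using that by (simp add: flat_fun_def)
  show "?\<psi> x = 1" if "b \<le> x" for x
    using that denominator[of x] by (simp add: flat_fun_def)
  have \<beta>: "(?\<beta> has_field_derivative ?\<beta>' x) (at x)" for x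
    using flat_fun_has_derivative[of 1 x] by simp
  have u: "(?u has_field_derivative ?u' x) (at x)" for x
    using DERIV_chain2[OF \<beta>, of "\<lambda>x. x - a" 1 x UNIV] DERIV_diff[OF DERIV_ident DERIV_const, of a x UNIV]
    by simp
  have v: "(?v has_field_derivative - ?v' x) (at x)" for x
    using DERIV_chain2[OF \<beta>, of "\<lambda>x. b - x" "-1" x UNIV] DERIV_diff[OF DERIV_const DERIV_ident, of b x UNIV]
    by simp
  have "(?\<psi> has_field_derivative (?u' x * ?v x + ?u x * ?v' x) / (?u x + ?v x)\<^sup>2) (at x)" for x
  proof (rule DERIV_cong[OF DERIV_divide[OF u DERIV_add[OF u v]]])
    show "?u x + ?v x \<noteq> 0"
      by (rule less_imp_neq[OF denominator, symmetric])
    have "?u' x * (?u x + ?v x) - ?u x * (?u' x + - ?v' x) = ?u' x * ?v x + ?u x * ?v' x"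
      by (simp only: distrib_left right_diff_distrib minus_mult_right[symmetric]) simp
    then show "(?u' x * (?u x + ?v x) - ?u x * (?u' x + - ?v' x)) / ((?u x + ?v x) * (?u x + ?v x)) =
        (?u' x * ?v x + ?u x * ?v' x) / (?u x + ?v x)\<^sup>2"
      by (simp only: power2_eq_square)
  qed
  then have d: "deriv ?\<psi> x = (?u' x * ?v x + ?u x * ?v' x) / (?u x + ?v x)\<^sup>2" for x
    by (rule DERIV_imp_deriv)
  show "0 \<le> deriv ?\<psi> x" for x
    unfolding d by (intro divide_nonneg_nonneg add_nonneg_nonneg mult_nonneg_nonneg nonneg) auto
  show "0 < deriv ?\<psi> x" if "a < x" "x < b" for x
    unfolding d using that denominator[of x]
    by (intro divide_pos_pos add_pos_pos mult_pos_pos pos zero_less_power) simp_all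
qed

section \<open>Increasing diffeomorphisms\<close>

definition increasing_diffeos :: "(real \<Rightarrow> real) set" where
  "increasing_diffeos = {f \<in> diffeos_real. \<forall>x. 0 < deriv f x}"

lemma diffeos_real_deriv_nonzero:
  assumes "f \<in> diffeos_real"
  shows "deriv f x \<noteq> 0"
proof -
  let ?g = "inv_into UNIV f"
  have f: "bij f" "smooth_real f" "smooth_real ?g"
    using assms by (auto simp: diffeos_real_def)
  have "((\<lambda>x. ?g (f x)) has_field_derivative deriv ?g (f x) * deriv f x) (at x)"
    by (rule DERIV_chain2[OF smooth_real_has_derivative[OF f(3)] smooth_real_has_derivative[OF f(2)]])
  moreover have "(\<lambda>x. ?g (f x)) = (\<lambda>x. x)"
    using f(1) by (simp add: bij_is_inj)
  ultimately have "deriv ?g (f x) * deriv f x = 1"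
    using DERIV_unique[OF _ DERIV_ident] by metis
  then show ?thesis by auto
qed

lemma pos_deriv_imp_strict_mono:
  assumes "smooth_real f" "\<And>x. 0 < deriv f x"
  shows "strict_mono f"
proof (rule strict_monoI)
  fix x y :: real assume "x < y"
  then show "f x < f y"
    by (rule DERIV_pos_imp_increasing) (blast intro: smooth_real_has_derivative assms)
qed

text \<open>Since \<open>f\<close> is monotone, values on both sides of every \<open>y\<close> give surjectivity by the
  intermediate value theorem, and the inverse is smooth because the derivative is nonzero.\<close>

lemma increasing_diffeosI:
  assumes smooth: "smooth_real f" and pos: "\<And>x. 0 < deriv f x"
    and unbounded: "\<And>y. \<exists>a b. f a \<le> y \<and> y \<le> f b"
  shows "f \<in> increasing_diffeos"
proof -
  have mono: "strict_mono f"
    by (rule pos_deriv_imp_strict_mono[OF smooth pos])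
  have "\<exists>x. f x = y" for y
  proof -
    obtain a b where ab: "f a \<le> y" "y \<le> f b" using unbounded by blast
    then have "a \<le> b" using mono strict_mono_less_eq order_trans by blast
    then show ?thesis
      using IVT'[of f a y b] ab smooth_real_continuous_on[OF smooth] by blast
  qed
  then have bij: "bij f"
    using mono strict_mono_imp_inj_on by (auto simp: bij_def surj_def) metis
  have "smooth_real (inv_into UNIV f)"
    by (rule smooth_real_inverse_function[OF smooth less_imp_neq[OF pos, symmetric]])
      (simp_all add: bij bij_is_inj bij_is_surj surj_f_inv_f)
  then show ?thesis
    using bij smooth pos by (simp add: increasing_diffeos_def diffeos_real_def)
qed

lemma increasing_diffeosD:
  assumes "f \<in> increasing_diffeos"
  shows "bij f" "smooth_real f" "0 < deriv f x" "strict_mono f"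
    "inv_into UNIV f (f x) = x" "f (inv_into UNIV f y) = y"
  using assms pos_deriv_imp_strict_mono[of f]
  by (auto simp: increasing_diffeos_def diffeos_real_def bij_is_inj bij_is_surj surj_f_inv_f)

lemma increasing_diffeos_id: "id \<in> increasing_diffeos"
  by (rule increasing_diffeosI) (auto simp: id_def smooth_real_ident)

lemma increasing_diffeos_comp:
  assumes "f \<in> increasing_diffeos" "g \<in> increasing_diffeos"
  shows "f \<circ> g \<in> increasing_diffeos"
proof (rule increasing_diffeosI)
  note f = increasing_diffeosD[OF assms(1)] and g = increasing_diffeosD[OF assms(2)]
  show "smooth_real (f \<circ> g)"
    using smooth_real_compose[OF f(2) g(2)] by (simp add: comp_def)
  have "deriv (f \<circ> g) x = deriv f (g x) * deriv g x" for x
    by (rule DERIV_imp_deriv[OF DERIV_chain])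
      (rule smooth_real_has_derivative f(2) g(2))+
  then show "0 < deriv (f \<circ> g) x" for x
    using f(3) g(3) by simp
  show "\<exists>a b. (f \<circ> g) a \<le> y \<and> y \<le> (f \<circ> g) b" for y
    by (rule exI[of _ "inv_into UNIV g (inv_into UNIV f y)"])+ (simp add: f(6) g(6))
qed

lemma increasing_diffeos_inv:
  assumes "f \<in> increasing_diffeos"
  shows "inv_into UNIV f \<in> increasing_diffeos"
proof (rule increasing_diffeosI)
  note f = increasing_diffeosD[OF assms]
  have nz: "deriv f x \<noteq> 0" for x
    using f(3)[of x] by simp
  show "smooth_real (inv_into UNIV f)"
    by (rule smooth_real_inverse_function[OF f(2) nz f(5,6)])
  have "deriv (inv_into UNIV f) y = inverse (deriv f (inv_into UNIV f y))" for y
    by (rule DERIV_imp_deriv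
        [OF inverse_function_has_derivative[OF smooth_real_has_derivative[OF f(2)] nz f(5,6)]])
  then show "0 < deriv (inv_into UNIV f) y" for y
    using f(3) by simp
  show "\<exists>a b. inv_into UNIV f a \<le> y \<and> y \<le> inv_into UNIV f b" for y
    by (rule exI[of _ "f y"])+ (simp add: f(5))
qed

lemma increasing_diffeos_funpow:
  "f \<in> increasing_diffeos \<Longrightarrow> f ^^ n \<in> increasing_diffeos"
  by (induction n) (auto intro: increasing_diffeos_id increasing_diffeos_comp)

section \<open>Fixed-point free diffeomorphisms are conjugate to a translation\<close>

text \<open>A bounded forward orbit would be increasing, hence converge, and its limit would be a fixed
  point.\<close>

lemma forward_orbit_unbounded:
  fixes h :: "real \<Rightarrow> real"
  assumes cont: "\<And>x. isCont h x" and above: "\<And>x. x < h x"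
  shows "\<exists>n. y < (h ^^ n) x"
proof (rule ccontr)
  assume "\<nexists>n. y < (h ^^ n) x"
  then have bounded: "(h ^^ n) x \<le> y" for n by (simp add: not_less)
  have "incseq (\<lambda>n. (h ^^ n) x)"
    using above by (intro incseq_SucI) (simp add: less_imp_le)
  then obtain L where L: "(\<lambda>n. (h ^^ n) x) \<longlonglongrightarrow> L"
    using bounded incseq_convergent[of "\<lambda>n. (h ^^ n) x" y] by blast
  have "(\<lambda>n. h ((h ^^ n) x)) \<longlonglongrightarrow> h L"
    by (rule isCont_tendsto_compose[OF cont L])
  moreover have "(\<lambda>n. h ((h ^^ n) x)) \<longlonglongrightarrow> L"
    using LIMSEQ_Suc[OF L] by simp
  ultimately have "h L = L" by (rule LIMSEQ_unique)
  then show False using above[of L] by simp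
qed

text \<open>A solution \<open>\<phi>\<close> of Abel's equation \<open>\<phi> (h x) = \<phi> x + 1\<close> conjugates \<open>h\<close> to the translation
  by \<open>1\<close>. For a smooth step \<open>\<psi>\<close> rising from \<open>0\<close> to \<open>1\<close>, the formal bi-infinite sum of
  \<open>\<psi> \<circ> h\<^sup>n\<close> over all integers \<open>n\<close> is invariant under \<open>h\<close>; it becomes locally finite once the
  constant \<open>1\<close> is subtracted from each term with \<open>n \<ge> 0\<close>, and this renormalisation turns
  invariance into Abel's equation. Below, the terms for \<open>n\<close> and \<open>- n - 1\<close> are paired. The sum
  has positive derivative because \<open>\<psi>\<close> has positive derivative on a neighbourhood of the interval
  from \<open>h\<inverse> 0\<close> to \<open>h 0\<close>, which every orbit visits.\<close>

lemma abel_function_exists: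
  assumes h: "h \<in> increasing_diffeos" and above: "\<And>x. x < h x"
  obtains \<phi> where "\<phi> \<in> increasing_diffeos" "\<And>x. \<phi> (h x) = \<phi> x + 1"
proof -
  define k where "k = inv_into UNIV h"
  note hD = increasing_diffeosD[OF h]
  have k: "k \<in> increasing_diffeos"
    unfolding k_def by (rule increasing_diffeos_inv[OF h])
  have kh: "k (h x) = x" and hk: "h (k x) = x" for x
    by (simp_all add: k_def hD)
  have below: "k x < x" for x
    using above[of "k x"] by (simp add: hk)
  have hn: "h ^^ n \<in> increasing_diffeos" and kn: "k ^^ n \<in> increasing_diffeos" for n
    by (rule increasing_diffeos_funpow[OF h], rule increasing_diffeos_funpow[OF k])
  have hn_less: "x < y \<Longrightarrow> (h ^^ n) x < (h ^^ n) y"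
    and kn_less: "x < y \<Longrightarrow> (k ^^ n) x < (k ^^ n) y" for n x y
    using increasing_diffeosD(4)[OF hn] increasing_diffeosD(4)[OF kn] by (auto dest: strict_monoD)
  have knhn: "(k ^^ n) ((h ^^ n) x) = x" for n x
    by (induction n arbitrary: x) (simp_all add: funpow_swap1 kh)
  have "incseq (\<lambda>n. (h ^^ n) x)" "decseq (\<lambda>n. (k ^^ n) x)" for x
    using above below by (auto intro!: incseq_SucI decseq_SucI simp: less_imp_le)
  then have hn_mono: "m \<le> n \<Longrightarrow> (h ^^ m) x \<le> (h ^^ n) x"
    and kn_antimono: "m \<le> n \<Longrightarrow> (k ^^ n) x \<le> (k ^^ m) x" for m n x
    by (auto dest: incseqD decseqD)
  have h_unbounded: "\<exists>n. y < (h ^^ n) x" for x y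
    using forward_orbit_unbounded[OF smooth_real_isCont[OF hD(2)] above] .
  have k_unbounded: "\<exists>n. (k ^^ n) x < y" for x y
    using h_unbounded[of x y] kn_less knhn by metis

  define a where "a = k 0 - 1"
  define b where "b = h 0 + 1"
  have "a < b"
    using above[of 0] below[of 0] by (simp add: a_def b_def)
  then obtain \<psi> where \<psi>: "smooth_real \<psi>" "\<And>x. x \<le> a \<Longrightarrow> \<psi> x = 0" "\<And>x. b \<le> x \<Longrightarrow> \<psi> x = 1"
    "\<And>x. 0 \<le> deriv \<psi> x" "\<And>x. a < x \<Longrightarrow> x < b \<Longrightarrow> 0 < deriv \<psi> x"
    by (rule smooth_step_exists) blast

  define t where "t n x = \<psi> ((k ^^ Suc n) x) + \<psi> ((h ^^ n) x) - 1" for n x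
  define t' where "t' n x = deriv \<psi> ((k ^^ Suc n) x) * deriv (k ^^ Suc n) x +
      deriv \<psi> ((h ^^ n) x) * deriv (h ^^ n) x" for n x
  define \<phi> where "\<phi> x = (\<Sum>n. t n x)" for x

  have stable: "\<exists>N. \<forall>n\<ge>N. \<forall>y. x - 1 < y \<and> y < x + 1 \<longrightarrow> \<psi> ((h ^^ n) y) = 1 \<and> \<psi> ((k ^^ n) y) = 0" for x
  proof -
    obtain N1 N2 where N: "b < (h ^^ N1) (x - 1)" "(k ^^ N2) (x + 1) < a"
      using h_unbounded k_unbounded by metis
    show ?thesis
    proof (intro exI[of _ "max N1 N2"] allI impI)
      fix n y assume n: "max N1 N2 \<le> n" and y: "x - 1 < y \<and> y < x + 1"
      have "b \<le> (h ^^ n) y"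
        using N(1) hn_mono[of N1 n "x - 1"] hn_less[of "x - 1" y n] n y by linarith
      moreover have "(k ^^ n) y \<le> a"
        using N(2) kn_antimono[of N2 n "x + 1"] kn_less[of y "x + 1" n] n y by linarith
      ultimately show "\<psi> ((h ^^ n) y) = 1 \<and> \<psi> ((k ^^ n) y) = 0"
        by (simp add: \<psi>)
    qed
  qed
  have local_sum: "\<exists>N. \<forall>M\<ge>N. \<forall>\<^sub>F y in nhds x. \<phi> y = (\<Sum>n<M. t n y)" for x
  proof -
    obtain N where N: "\<And>n y. N \<le> n \<Longrightarrow> x - 1 < y \<Longrightarrow> y < x + 1 \<Longrightarrow> \<psi> ((h ^^ n) y) = 1 \<and> \<psi> ((k ^^ n) y) = 0"
      using stable[of x] by blast
    have "\<phi> y = (\<Sum>n<M. t n y)" if "N \<le> M" "x - 1 < y" "y < x + 1" for M y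
      unfolding \<phi>_def
    proof (rule suminf_finite)
      fix n assume "n \<notin> {..<M}"
      then have "N \<le> n" "N \<le> Suc n" using that(1) by auto
      then show "t n y = 0"
        using N[of n y] N[of "Suc n" y] that unfolding t_def by simp
    qed simp
    moreover have "\<forall>\<^sub>F y in nhds x. y \<in> {x - 1<..<x + 1}"
      by (rule eventually_nhds_in_open) auto
    ultimately have "\<forall>\<^sub>F y in nhds x. \<phi> y = (\<Sum>n<M. t n y)" if "N \<le> M" for M
      using that by (auto elim!: eventually_mono)
    then show ?thesis by blast
  qed

  have t_smooth: "smooth_real (t n)" for n
    unfolding t_def
    by (intro smooth_real_diff smooth_real_add smooth_real_const smooth_real_compose[OF \<psi>(1)]
        increasing_diffeosD(2)[OF hn] increasing_diffeosD(2)[OF kn])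
  have t_deriv: "(t n has_field_derivative t' n x) (at x)" for n x
    unfolding t_def t'_def
    by (rule DERIV_cong[OF DERIV_diff[OF DERIV_add[OF DERIV_chain2 DERIV_chain2] DERIV_const]])
      (simp_all add: smooth_real_has_derivative \<psi>(1) increasing_diffeosD(2)[OF hn]
        increasing_diffeosD(2)[OF kn] del: funpow.simps)
  have t'_nonneg: "0 \<le> t' n x" for n x
    unfolding t'_def
    by (intro add_nonneg_nonneg mult_nonneg_nonneg \<psi>(4) less_imp_le[OF increasing_diffeosD(3)[OF hn]]
        less_imp_le[OF increasing_diffeosD(3)[OF kn]])
  have t'_pos: "\<exists>n. 0 < t' n x" for x
  proof (cases "x < 0")
    case True
    \<comment> \<open>The first nonnegative point of the forward orbit lies in the interval from \<open>0\<close> to \<open>h 0\<close>.\<close>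
    have "\<exists>n. 0 \<le> (h ^^ n) x"
      using h_unbounded[of 0 x] less_imp_le by blast
    then obtain n where n: "0 \<le> (h ^^ n) x" "\<And>m. m < n \<Longrightarrow> \<not> 0 \<le> (h ^^ m) x"
      using exists_least_iff[of "\<lambda>n. 0 \<le> (h ^^ n) x"] by blast
    obtain m where m: "n = Suc m" using n(1) True by (cases n) auto
    have "(h ^^ n) x < h 0"
      using n(2)[of m] hn_less[of _ 0 1] by (simp add: m)
    then have "0 < deriv \<psi> ((h ^^ n) x)"
      using n(1) below[of 0] by (intro \<psi>(5)) (simp_all add: a_def b_def)
    then have "0 < t' n x"
      unfolding t'_def
      by (intro add_nonneg_pos mult_nonneg_nonneg mult_pos_pos \<psi>(4)
          less_imp_le[OF increasing_diffeosD(3)[OF kn]] increasing_diffeosD(3)[OF hn])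
    then show ?thesis ..
  next
    case False
    \<comment> \<open>The first negative point of the backward orbit lies in the interval from \<open>k 0\<close> to \<open>0\<close>.\<close>
    obtain n where n: "(k ^^ n) x < 0" "\<And>m. m < n \<Longrightarrow> \<not> (k ^^ m) x < 0"
      using exists_least_iff[of "\<lambda>n. (k ^^ n) x < 0"] k_unbounded[of x 0] by blast
    obtain m where m: "n = Suc m" using n(1) False by (cases n) auto
    have "k 0 \<le> (k ^^ n) x"
      using n(2)[of m] kn_less[of 0 "(k ^^ m) x" 1] by (cases "(k ^^ m) x = 0") (simp_all add: m)
    then have "0 < deriv \<psi> ((k ^^ Suc m) x)"
      using n(1) above[of 0] unfolding m by (intro \<psi>(5)) (simp_all add: a_def b_def)
    then have "0 < t' m x"
      unfolding t'_def
      by (intro add_pos_nonneg mult_nonneg_nonneg mult_pos_pos \<psi>(4)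
          less_imp_le[OF increasing_diffeosD(3)[OF hn]] increasing_diffeosD(3)[OF kn])
    then show ?thesis ..
  qed

  have smooth: "smooth_real \<phi>"
  proof (rule smooth_real_locally)
    fix x
    obtain N where "\<forall>\<^sub>F y in nhds x. \<phi> y = (\<Sum>n<N. t n y)"
      using local_sum[of x] by blast
    moreover have "smooth_real (\<lambda>y. \<Sum>n<N. t n y)"
      by (rule smooth_real_sum[OF t_smooth])
    ultimately show "\<exists>g. smooth_real g \<and> (\<forall>\<^sub>F y in nhds x. \<phi> y = g y)"
      by blast
  qed
  have deriv_pos: "0 < deriv \<phi> x" for x
  proof -
    obtain N where N: "\<And>M. N \<le> M \<Longrightarrow> \<forall>\<^sub>F y in nhds x. \<phi> y = (\<Sum>n<M. t n y)"
      using local_sum[of x] by blast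
    obtain m where m: "0 < t' m x" using t'_pos by blast
    define M where "M = max N (Suc m)"
    have "((\<lambda>y. \<Sum>n<M. t n y) has_field_derivative (\<Sum>n<M. t' n x)) (at x)"
      by (rule DERIV_sum[OF t_deriv])
    then have "(\<phi> has_field_derivative (\<Sum>n<M. t' n x)) (at x)"
      using N[of M] by (subst DERIV_cong_ev[OF refl _ refl]) (auto simp: M_def)
    then have "deriv \<phi> x = (\<Sum>n<M. t' n x)"
      by (rule DERIV_imp_deriv)
    also have "\<dots> > 0"
      by (rule sum_pos2[of _ m]) (use m t'_nonneg in \<open>auto simp: M_def\<close>)
    finally show ?thesis .
  qed
  have abel: "\<phi> (h x) = \<phi> x + 1" for x
  proof -
    obtain N1 where N1: "\<And>M. N1 \<le> M \<Longrightarrow> \<phi> x = (\<Sum>n<M. t n x)"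
      using local_sum[of x] eventually_nhds_x_imp_x by meson
    obtain N2 where N2: "\<And>M. N2 \<le> M \<Longrightarrow> \<phi> (h x) = (\<Sum>n<M. t n (h x))"
      using local_sum[of "h x"] eventually_nhds_x_imp_x by meson
    obtain N3 where N3: "\<And>M. N3 \<le> M \<Longrightarrow> \<psi> ((h ^^ M) x) = 1 \<and> \<psi> ((k ^^ M) x) = 0"
      using stable[of x] by force
    define M where "M = max N1 (max N2 N3)"
    have "t n (h x) - t n x = (\<psi> ((h ^^ Suc n) x) - \<psi> ((k ^^ Suc n) x)) - (\<psi> ((h ^^ n) x) - \<psi> ((k ^^ n) x))" for n
      by (simp add: t_def funpow_swap1 kh)
    then have "(\<Sum>n<M. t n (h x) - t n x) = \<psi> ((h ^^ M) x) - \<psi> ((k ^^ M) x) - (\<psi> x - \<psi> x)"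
      using sum_lessThan_telescope[of "\<lambda>n. \<psi> ((h ^^ n) x) - \<psi> ((k ^^ n) x)" M] by simp
    then have "(\<Sum>n<M. t n (h x)) - (\<Sum>n<M. t n x) = 1"
      using N3[of M] by (simp add: sum_subtractf M_def)
    then show ?thesis
      using N1[of M] N2[of M] by (simp add: M_def)
  qed
  have up: "\<phi> ((h ^^ n) 0) = \<phi> 0 + real n" for n
    by (induction n) (simp_all add: abel)
  have down: "\<phi> ((k ^^ n) 0) = \<phi> 0 - real n" for n
  proof (induction n)
    case (Suc n)
    then show ?case using abel[of "k ((k ^^ n) 0)"] by (simp add: hk)
  qed simp
  have "\<exists>u v. \<phi> u \<le> y \<and> y \<le> \<phi> v" for y
  proof -
    obtain m n where "\<phi> 0 - y \<le> real m" "y - \<phi> 0 \<le> real n"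
      using real_arch_simple by meson
    then have "\<phi> ((k ^^ m) 0) \<le> y \<and> y \<le> \<phi> ((h ^^ n) 0)"
      by (simp add: up down)
    then show ?thesis by blast
  qed
  then have "\<phi> \<in> increasing_diffeos"
    by (rule increasing_diffeosI[OF smooth deriv_pos])
  then show ?thesis using abel that by blast
qed

section \<open>Increasing diffeomorphisms are commutators\<close>

text \<open>The soft maximum \<open>ln (exp x + exp (f\<inverse> x))\<close> of the identity and \<open>f\<inverse>\<close> is a diffeomorphism
  above both of them, and \<open>x < f (h x)\<close> just says that \<open>h\<close> is above \<open>f\<inverse>\<close>.\<close>

lemma increasing_diffeo_dominating:
  assumes "f \<in> increasing_diffeos"
  obtains h where "h \<in> increasing_diffeos" "\<And>x. x < h x" "\<And>x. x < f (h x)"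
proof -
  define k where "k = inv_into UNIV f"
  define h where "h x = ln (exp x + exp (k x))" for x
  have k: "k \<in> increasing_diffeos"
    unfolding k_def by (rule increasing_diffeos_inv[OF assms])
  note fD = increasing_diffeosD[OF assms] and kD = increasing_diffeosD[OF k]
  have pos: "0 < exp x + exp (k x)" for x
    by (simp add: add_pos_pos)
  have exp_h: "exp (h x) = exp x + exp (k x)" for x
    unfolding h_def by (rule exp_ln[OF pos])
  have gt: "x < h x" "k x < h x" for x
  proof -
    have "exp x < exp (h x)" "exp (k x) < exp (h x)"
      unfolding exp_h by simp_all
    then show "x < h x" "k x < h x" by simp_all
  qed
  have "x < f (h x)" for x
    using gt(2)[of x] strict_monoD[OF fD(4), of "k x" "h x"] by (simp add: k_def fD(6))
  moreover have "h \<in> increasing_diffeos"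
  proof (rule increasing_diffeosI)
    show "smooth_real h"
      unfolding h_def
      by (rule smooth_real_ln[OF _ pos])
        (intro smooth_real_add smooth_real_exp smooth_real_compose[OF smooth_real_exp kD(2)])
    have "(h has_field_derivative (exp x + exp (k x) * deriv k x) / (exp x + exp (k x))) (at x)" for x
      unfolding h_def using smooth_real_has_derivative[OF kD(2), of x] pos[of x]
      by (auto intro!: derivative_eq_intros)
    then have "deriv h x = (exp x + exp (k x) * deriv k x) / (exp x + exp (k x))" for x
      by (rule DERIV_imp_deriv)
    then show "0 < deriv h x" for x
      using pos[of x] kD(3)[of x] by (simp add: add_pos_pos)
    show "\<exists>u v. h u \<le> y \<and> y \<le> h v" for y
    proof -
      \<comment> \<open>At \<open>u\<close> both exponentials are at most half of \<open>exp y\<close>.\<close>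
      define u where "u = min (y - ln 2) (f (y - ln 2))"
      have "k u \<le> y - ln 2"
        using strict_mono_less_eq[OF kD(4), of u "f (y - ln 2)"] by (simp add: u_def k_def fD(5))
      moreover have "u \<le> y - ln 2" by (simp add: u_def)
      ultimately have "exp u \<le> exp (y - ln 2)" "exp (k u) \<le> exp (y - ln 2)" by simp_all
      then have "exp (h u) \<le> exp y" by (simp add: exp_h exp_diff)
      then have "h u \<le> y" by simp
      then show ?thesis using gt(1)[of y] less_imp_le by blast
    qed
  qed
  ultimately show ?thesis using gt(1) that by blast
qed

text \<open>For \<open>h\<close> as in \<open>increasing_diffeo_dominating\<close>, both \<open>h\<close> and \<open>f \<circ> h\<close> are conjugate to the
  translation by \<open>1\<close>, hence to each other.\<close>

lemma increasing_diffeo_is_commutator: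
  assumes f: "f \<in> increasing_diffeos"
  obtains g h where "g \<in> increasing_diffeos" "h \<in> increasing_diffeos"
    "f = g \<circ> h \<circ> inv_into UNIV g \<circ> inv_into UNIV h"
proof -
  obtain h where h: "h \<in> increasing_diffeos" "\<And>x. x < h x" "\<And>x. x < f (h x)"
    using increasing_diffeo_dominating[OF f] by metis
  obtain \<phi> where \<phi>: "\<phi> \<in> increasing_diffeos" "\<And>x. \<phi> (h x) = \<phi> x + 1"
    using abel_function_exists[OF h(1,2)] by metis
  obtain \<theta> where \<theta>: "\<theta> \<in> increasing_diffeos" "\<And>x. \<theta> (f (h x)) = \<theta> x + 1"
    using abel_function_exists[OF increasing_diffeos_comp[OF f h(1)]] h(3) by (metis comp_apply)
  define g where "g = inv_into UNIV \<theta> \<circ> \<phi>"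
  have g: "g \<in> increasing_diffeos"
    unfolding g_def by (rule increasing_diffeos_comp[OF increasing_diffeos_inv[OF \<theta>(1)] \<phi>(1)])
  have conj: "g (h x) = f (h (g x))" for x
  proof -
    have "\<theta> (g (h x)) = \<phi> x + 1"
      by (simp add: g_def increasing_diffeosD(6)[OF \<theta>(1)] \<phi>(2))
    also have "\<dots> = \<theta> (f (h (g x)))"
      by (simp add: g_def increasing_diffeosD(6)[OF \<theta>(1)] \<theta>(2))
    finally show ?thesis
      using increasing_diffeosD(5)[OF \<theta>(1)] by metis
  qed
  have "f x = (g \<circ> h \<circ> inv_into UNIV g \<circ> inv_into UNIV h) x" for x
    by (simp add: conj increasing_diffeosD(6)[OF g] increasing_diffeosD(6)[OF h(1)])
  then show ?thesis using g h(1) that by blast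
qed

section \<open>The identity component\<close>

lemma openin_Ck_nbhd:
  "f \<in> diffeos_real \<Longrightarrow> compact K \<Longrightarrow> 0 < e \<Longrightarrow>
     openin compact_open_smooth_topology (Ck_nbhd f K k e)"
  unfolding compact_open_smooth_topology_def by (rule topology_generated_by_Basis) blast

lemma topspace_compact_open_smooth_topology:
  "topspace compact_open_smooth_topology = diffeos_real"
proof
  show "topspace compact_open_smooth_topology \<subseteq> diffeos_real"
    unfolding compact_open_smooth_topology_def topology_generated_by_topspace
    by (auto simp: Ck_nbhd_def)
  show "diffeos_real \<subseteq> topspace compact_open_smooth_topology"
  proof
    fix f assume f: "f \<in> diffeos_real"
    then have "f \<in> Ck_nbhd f {} 0 1"
      by (simp add: Ck_nbhd_def)
    moreover have "openin compact_open_smooth_topology (Ck_nbhd f {} 0 1)"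
      by (rule openin_Ck_nbhd[OF f]) simp_all
    ultimately show "f \<in> topspace compact_open_smooth_topology"
      using openin_subset by blast
  qed
qed

text \<open>The value of the derivative at a point is a continuous function on the diffeomorphisms.\<close>

lemma openin_deriv_at:
  assumes "open U"
  shows "openin compact_open_smooth_topology {f \<in> diffeos_real. deriv f x \<in> U}"
proof (subst openin_subopen, intro ballI)
  fix f assume f: "f \<in> {f \<in> diffeos_real. deriv f x \<in> U}"
  then obtain e where e: "0 < e" "ball (deriv f x) e \<subseteq> U"
    using assms by (auto simp: open_contains_ball)
  have "openin compact_open_smooth_topology (Ck_nbhd f {x} 1 e)"
    using f e by (intro openin_Ck_nbhd) auto
  moreover have "f \<in> Ck_nbhd f {x} 1 e"
    using f e by (simp add: Ck_nbhd_def)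
  moreover have "Ck_nbhd f {x} 1 e \<subseteq> {f \<in> diffeos_real. deriv f x \<in> U}"
  proof
    fix g assume g: "g \<in> Ck_nbhd f {x} 1 e"
    then have "\<bar>(deriv ^^ 1) g x - (deriv ^^ 1) f x\<bar> < e"
      unfolding Ck_nbhd_def by blast
    then have "deriv g x \<in> ball (deriv f x) e"
      by (simp add: dist_real_def abs_minus_commute)
    then show "g \<in> {f \<in> diffeos_real. deriv f x \<in> U}"
      using g e by (auto simp: Ck_nbhd_def)
  qed
  ultimately show "\<exists>T. openin compact_open_smooth_topology T \<and> f \<in> T \<and>
      T \<subseteq> {f \<in> diffeos_real. deriv f x \<in> U}"
    by blast
qed

lemma higher_deriv_linear_combination:
  assumes "smooth_real f" "smooth_real g"
  shows "(deriv ^^ j) (\<lambda>x. a * f x + b * g x) = (\<lambda>x. a * (deriv ^^ j) f x + b * (deriv ^^ j) g x)"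
proof (induction j)
  case (Suc j)
  have "deriv (\<lambda>x. a * (deriv ^^ j) f x + b * (deriv ^^ j) g x) x =
      a * deriv ((deriv ^^ j) f) x + b * deriv ((deriv ^^ j) g) x" for x
    by (intro DERIV_imp_deriv DERIV_add DERIV_cmult smooth_real_has_derivative
        smooth_real_higher_deriv assms)
  then show ?case by (simp add: Suc)
qed simp

lemma convex_combination_increasing_diffeo:
  assumes f: "f \<in> increasing_diffeos" and t: "t \<in> {0..1}"
  shows "(\<lambda>x. (1 - t) * x + t * f x) \<in> increasing_diffeos"
proof (rule increasing_diffeosI)
  note fD = increasing_diffeosD[OF f]
  let ?F = "\<lambda>x. (1 - t) * x + t * f x"
  show "smooth_real ?F"
    by (intro smooth_real_add smooth_real_mult smooth_real_const smooth_real_ident fD(2))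
  have "deriv ?F x = (1 - t) * 1 + t * deriv f x" for x
    by (intro DERIV_imp_deriv DERIV_add DERIV_cmult DERIV_ident smooth_real_has_derivative fD(2))
  moreover have "0 < (1 - t) * 1 + t * deriv f x" for x
    using t fD(3)[of x] by (cases "t = 0") (auto intro: add_nonneg_pos)
  ultimately show "0 < deriv ?F x" for x by simp
  have convex: "(1 - t) * u + t * v \<le> y" if "u \<le> y" "v \<le> y" for u v y :: real
    using convex_bound_le[of u y v "1 - t" t] that t by simp
  have concave: "y \<le> (1 - t) * u + t * v" if "y \<le> u" "y \<le> v" for u v y :: real
    using convex[of "- u" "- y" "- v"] that by simp
  show "\<exists>a b. ?F a \<le> y \<and> y \<le> ?F b" for y
  proof (intro exI conjI)
    let ?z = "inv_into UNIV f y"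
    have "f (min y ?z) \<le> f ?z" "f ?z \<le> f (max y ?z)"
      by (simp_all add: strict_mono_less_eq[OF fD(4)])
    then show "?F (min y ?z) \<le> y" "y \<le> ?F (max y ?z)"
      by (auto intro!: convex concave simp: fD(6))
  qed
qed

text \<open>Each derivative of the straight path from the identity to \<open>f\<close> depends continuously on the
  parameter and the point together. The parameters for which an estimate fails at some point of a
  compact set \<open>K\<close> therefore form a closed set, as a projection along \<open>K\<close>.\<close>

lemma continuous_map_straight_path:
  assumes f: "f \<in> increasing_diffeos"
  shows "continuous_map (top_of_set {0..1}) compact_open_smooth_topology
           (\<lambda>t x. (1 - t) * x + t * f x)"
  unfolding compact_open_smooth_topology_def
proof (rule continuous_on_generated_topo)
  let ?\<gamma> = "\<lambda>t x. (1 - t) * x + t * f x"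
  note fD = increasing_diffeosD[OF f]
  have \<gamma>: "?\<gamma> t \<in> diffeos_real" if "t \<in> {0..1}" for t
    using convex_combination_increasing_diffeo[OF f that] by (simp add: increasing_diffeos_def)
  show "?\<gamma> ` topspace (top_of_set {0..1}) \<subseteq>
      \<Union> {Ck_nbhd f K k e | f K k e. f \<in> diffeos_real \<and> compact K \<and> 0 < e}"
    using \<gamma> topspace_compact_open_smooth_topology
    unfolding compact_open_smooth_topology_def topology_generated_by_topspace by auto
  fix U assume "U \<in> {Ck_nbhd f K k e | f K k e. f \<in> diffeos_real \<and> compact K \<and> 0 < e}"
  then obtain g K k e where U: "U = Ck_nbhd g K k e" and g: "g \<in> diffeos_real" and K: "compact K"
    by blast
  have g_smooth: "smooth_real g" using g by (simp add: diffeos_real_def)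
  define F where "F j p = (1 - snd p) * (deriv ^^ j) (\<lambda>x. x) (fst p) + snd p * (deriv ^^ j) f (fst p)
      - (deriv ^^ j) g (fst p)" for j and p :: "real \<times> real"
  have F: "(deriv ^^ j) (?\<gamma> t) x - (deriv ^^ j) g x = F j (x, t)" for j t x
    by (simp add: F_def higher_deriv_linear_combination[OF smooth_real_ident fD(2)])
  have "continuous_on UNIV (\<lambda>p::real \<times> real. (deriv ^^ j) u (fst p))" if "smooth_real u" for u j
    by (rule continuous_on_compose2[OF smooth_real_continuous_on[OF smooth_real_higher_deriv[OF that], where S = UNIV]
          continuous_on_fst[OF continuous_on_id]]) simp
  note this[OF smooth_real_ident] this[OF fD(2)] this[OF g_smooth]
  then have cont: "continuous_on UNIV (F j)" for j
    unfolding F_def by (intro continuous_intros)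
  have "open {t. \<forall>x\<in>K. \<bar>F j (x, t)\<bar> < e}" for j
  proof -
    have "closed {p. e \<le> \<bar>F j p\<bar>}"
      by (intro closed_Collect_le continuous_intros cont)
    from closed_compact_projection[OF K this]
    have "closed {t. \<exists>x. x \<in> K \<and> e \<le> \<bar>F j (x, t)\<bar>}" by simp
    moreover have "{t. \<exists>x. x \<in> K \<and> e \<le> \<bar>F j (x, t)\<bar>} = - {t. \<forall>x\<in>K. \<bar>F j (x, t)\<bar> < e}"
      by (auto simp: not_less)
    ultimately show ?thesis by (simp add: open_closed)
  qed
  then have "open (\<Inter>j\<in>{..k}. {t. \<forall>x\<in>K. \<bar>F j (x, t)\<bar> < e})"
    by (intro open_INT) auto
  moreover have "?\<gamma> -` U \<inter> {0..1} = {0..1} \<inter> (\<Inter>j\<in>{..k}. {t. \<forall>x\<in>K. \<bar>F j (x, t)\<bar> < e})"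
    using \<gamma> unfolding U Ck_nbhd_def by (auto simp: F)
  ultimately show "openin (top_of_set {0..1}) (?\<gamma> -` U \<inter> topspace (top_of_set {0..1}))"
    by (simp add: openin_open_Int)
qed

text \<open>A connected set of diffeomorphisms cannot contain both signs of the derivative at a point,
  since that derivative never vanishes; conversely the straight path joins each increasing
  diffeomorphism to the identity.\<close>

lemma identity_component_eq_increasing_diffeos:
  "{f. connected_component_of compact_open_smooth_topology id f} = increasing_diffeos"
proof (intro equalityI subsetI)
  let ?X = compact_open_smooth_topology
  fix f assume "f \<in> {f. connected_component_of ?X id f}"
  then obtain C where C: "connectedin ?X C" "id \<in> C" "f \<in> C"
    by (auto simp: connected_component_of_def)
  have f: "f \<in> diffeos_real"
    using connectedin_subset_topspace[OF C(1)] C(3) topspace_compact_open_smooth_topology by blast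
  have "0 < deriv f x" for x
  proof -
    let ?P = "{f \<in> diffeos_real. deriv f x \<in> {0<..}}" and ?N = "{f \<in> diffeos_real. deriv f x \<in> {..<0}}"
    have "openin ?X ?P" "openin ?X ?N"
      by (rule openin_deriv_at; simp)+
    moreover have "\<not> deriv g x < 0 \<longleftrightarrow> 0 < deriv g x" if "g \<in> diffeos_real" for g
      using diffeos_real_deriv_nonzero[OF that, of x] by linarith
    then have "topspace ?X - ?N = ?P"
      by (auto simp: topspace_compact_open_smooth_topology)
    ultimately have "closedin ?X ?P" "openin ?X ?P"
      using closedin_diff[OF closedin_topspace, of ?X ?N] by simp_all
    then have "C \<subseteq> ?P \<or> disjnt C ?P"
      by (rule connectedin_clopen_cases[OF C(1)])
    moreover have "id \<in> ?P"
      using increasing_diffeos_id by (simp add: increasing_diffeos_def)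
    ultimately show ?thesis using C by (auto simp: disjnt_def)
  qed
  then show "f \<in> increasing_diffeos"
    using f by (simp add: increasing_diffeos_def)
next
  fix f assume f: "f \<in> increasing_diffeos"
  let ?\<gamma> = "\<lambda>t x. (1 - t) * x + t * f x"
  have "connectedin compact_open_smooth_topology (?\<gamma> ` {0..1})"
    by (rule connectedin_continuous_map_image[OF continuous_map_straight_path[OF f]])
      (simp add: connectedin_subtopology)
  moreover have "id \<in> ?\<gamma> ` {0..1}"
    by (rule image_eqI[of _ _ 0]) (simp_all add: fun_eq_iff)
  moreover have "f \<in> ?\<gamma> ` {0..1}"
    by (rule image_eqI[of _ _ 1]) simp_all
  ultimately show "f \<in> {f. connected_component_of compact_open_smooth_topology id f}"
    unfolding connected_component_of_def by blast
qed

section \<open>Commutator width\<close>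

lemma Diff0_real_simps:
  "carrier Diff0_real = increasing_diffeos" "f \<otimes>\<^bsub>Diff0_real\<^esub> g = f \<circ> g" "\<one>\<^bsub>Diff0_real\<^esub> = id"
  by (simp_all add: Diff0_real_def Diff_real_def identity_component_eq_increasing_diffeos)

lemma group_Diff0_real: "group Diff0_real"
proof (rule groupI, unfold Diff0_real_simps)
  fix f assume f: "f \<in> increasing_diffeos"
  have "inv_into UNIV f \<circ> f = id"
    by (simp add: fun_eq_iff increasing_diffeosD(5)[OF f])
  then show "\<exists>g\<in>increasing_diffeos. g \<circ> f = id"
    using increasing_diffeos_inv[OF f] by blast
qed (auto simp: comp_assoc intro: increasing_diffeos_comp increasing_diffeos_id)

lemma inv_Diff0_real:
  assumes "f \<in> increasing_diffeos"
  shows "inv\<^bsub>Diff0_real\<^esub> f = inv_into UNIV f"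
  by (rule group.inv_equality[OF group_Diff0_real])
    (use assms in \<open>auto simp: Diff0_real_simps fun_eq_iff increasing_diffeos_inv increasing_diffeosD(5)\<close>)

theorem corollary5:
  shows "commutator_width Diff0_real = 1"
proof -
  let ?S = "commutators Diff0_real \<union> {inv\<^bsub>Diff0_real\<^esub> c | c. c \<in> commutators Diff0_real}"
  have "f \<in> products_of_length Diff0_real 1 ?S" if f: "f \<in> increasing_diffeos" for f
  proof -
    obtain g h where "g \<in> increasing_diffeos" "h \<in> increasing_diffeos"
      "f = g \<circ> h \<circ> inv_into UNIV g \<circ> inv_into UNIV h"
      using increasing_diffeo_is_commutator[OF f] by blast
    then have "f \<in> commutators Diff0_real"
      unfolding commutators_def Diff0_real_simps mem_Collect_eq by (metis inv_Diff0_real)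
    then show ?thesis
      unfolding products_of_length_def Diff0_real_simps
      by (intro CollectI exI[of _ "[f]"]) simp
  qed
  moreover have "derived Diff0_real (carrier Diff0_real) \<subseteq> increasing_diffeos"
    using group.derived_in_carrier[OF group_Diff0_real, of "carrier Diff0_real"]
    by (simp add: Diff0_real_simps)
  ultimately have "commutator_width Diff0_real \<le> enat 1"
    unfolding commutator_width_def by (intro Inf_lower) blast
  moreover have "enat 1 \<le> commutator_width Diff0_real"
    unfolding commutator_width_def by (rule Inf_greatest) auto
  ultimately show ?thesis by (simp add: one_enat_def)
qed

end
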